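(* Let $\Gamma$ be a stationary Gibbs point process on $\mathbb{R}^d$ (with marks in $\mathbb{M}$) with Papangelou intensity $\lambda^*$, and let the following assumptions be satisfied: (a1) For all $m\in\mathbb{M}$, $\mathbb{E}\,\lambda^*((0,m),\Gamma)^2<\infty$. (a2) There exist a function $\phi:\mathbb{R}^d\to\mathbb{R}$ and $\delta\ge 0$ such that $\int_{\mathbb{R}^d\setminus B(0,\delta)}\phi(x)\,dx<\infty$ and, for any $\mathbf{x}=(x,m_x)\in E$ and $\mathbf{y}=(y,m_y)\in E$ with $\|x-y\|>\delta$ and any $\gamma\in\mathbf{N}$, $$\left|1-\frac{\lambda^*(\mathbf{x},\gamma\cup\{\mathbf{y}\})}{\lambda^*(\mathbf{x},\gamma)}\right|\le\phi(x-y).$$ Then there is a constant $\mathcal{C}_{nhyp}>0$ not depending on the bounded set $\Lambda\subset\mathbb{R}^d$ such that $$\frac{\mathrm{Var}(N_\Lambda(\Gamma))}{|\Lambda|}\ge\mathcal{C}_{nhyp}>0.$$ In particular, $\Gamma$ is not hyperuniform.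
   Context: $\mathbb{M}$ is a complete, separable mark space with its Borel $\sigma$-algebra and a finite measure $\lambda_{\mathbb{M}}$; $E=\mathbb{R}^d\times\mathbb{M}$ carries the product $\sigma$-field and the reference measure $\nu=\lambda\otimes\lambda_{\mathbb{M}}$, where $\lambda$ is Lebesgue measure on $\mathbb{R}^d$; $|\Lambda|$ denotes the volume of $\Lambda$. $\mathbf{N}$ is the set of locally finite configurations, i.e. of all $\gamma\subset E$ such that $\gamma\cap(\Lambda\times\mathbb{M})$ is finite for every bounded $\Lambda\subset\mathbb{R}^d$, equipped with the smallest $\sigma$-field making all projections $\gamma\mapsto\gamma\cap A$ measurable for measurable $A\subset E$. A point process is a probability measure $\Gamma$ on $\mathbf{N}$; $\Gamma$ also denotes a random configuration with this law, and $\mathbb{E}$ and $\mathrm{Var}$ are taken with respect to it. For bounded $\Lambda\subset\mathbb{R}^d$, $N_\Lambda(\gamma)$ is the number of points of $\gamma$ in $\Lambda\times\mathbb{M}$. $B(x,r)$ is the Euclidean ball with centre $x$ and radius $r$. For $u\in\mathbb{R}^d$ let $\tau_u(x,m)=(x+u,m)$, applied pointwise to configurations; $\Gamma$ is stationary if $\tau_u\Gamma$ has the same distribution as $\Gamma$ for all $u\in\mathbb{R}^d$. Let $\lambda^*:E\times\mathbf{N}\to\mathbb{R}$ be a measurable function. $\Gamma$ is a Gibbs point process with Papangelou intensity $\lambda^*$ if for all positive measurable $f:E\times\mathbf{N}\to\mathbb{R}$, $$\int_{\mathbf{N}}\sum_{\mathbf{x}\in\gamma}f(\mathbf{x},\gamma\setminus\{\mathbf{x}\})\,\Gamma(d\gamma)=\int_{\mathbf{N}}\int_E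 f(\mathbf{x},\gamma)\lambda^*(\mathbf{x},\gamma)\,\nu(d\mathbf{x})\,\Gamma(d\gamma).$$ For stationary $\Gamma$, $\lambda^*$ is translation invariant: $\lambda^*(\mathbf{x},\gamma)=\lambda^*(\tau_u\mathbf{x},\tau_u\gamma)$ for all $u\in\mathbb{R}^d$. A stationary point process $\Gamma$ is hyperuniform if $\lim_{\Lambda\nearrow\mathbb{R}^d}\mathrm{Var}(N_\Lambda(\Gamma))/|\Lambda|=0$, where $\Lambda\nearrow\mathbb{R}^d$ means any sequence of increasing sets $\Lambda_1\subseteq\Lambda_2\subseteq\dots$ tending to the whole space $\mathbb{R}^d$.
   Formalization: The formal theorem also assumes that Γ is not almost surely the empty configuration; without this the claim fails, e.g. for zero mark measure, λ* = 1, φ = 0 and Γ the empty process, where the variance is 0. *)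

theory Defs
  imports "HOL-Probability.Probability"
begin

definition configs :: "((real ^ 'd) \<times> 'm) set set" where
  "configs = {\<gamma>. \<forall>\<Lambda>. bounded \<Lambda> \<longrightarrow> finite (\<gamma> \<inter> \<Lambda> \<times> UNIV)}"

(* Measurability of the restrictions of a configuration to A is, as usual, measurability of the
   number of points in A; the counting measure gives the value \<infinity> (and not 0, as card would)
   when there are infinitely many points. *)
definition config_space :: "((real ^ 'd) \<times> 'm::polish_space) set measure" where
  "config_space =
     (SUP A \<in> sets borel. vimage_algebra configs (\<lambda>\<gamma>. emeasure (count_space UNIV) (\<gamma> \<inter> A)) borel)"

definition point_process :: "((real ^ 'd) \<times> 'm::polish_space) set measure \<Rightarrow> bool" where
  "point_process \<Gamma> \<longleftrightarrow> prob_space \<Gamma> \<and> sets \<Gamma> = sets config_space"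

definition translate :: "real ^ 'd \<Rightarrow> (real ^ 'd) \<times> 'm \<Rightarrow> (real ^ 'd) \<times> 'm" where
  "translate u = (\<lambda>(x, m). (x + u, m))"

definition stationary :: "((real ^ 'd) \<times> 'm::polish_space) set measure \<Rightarrow> bool" where
  "stationary \<Gamma> \<longleftrightarrow> (\<forall>u. distr \<Gamma> config_space (\<lambda>\<gamma>. translate u ` \<gamma>) = \<Gamma>)"

(* The integrals are integrals of nonnegative functions with values in [0, \<infinity>], for which ennreal
   truncates negative numbers to 0. That \<kappa> is nonnegative almost everywhere is therefore stated
   separately; it is what the untruncated equation says for f the indicator of {\<kappa> < 0}. *)
definition papangelou_intensity ::
  "'m measure \<Rightarrow> ((real ^ 'd) \<times> 'm::polish_space) set measure \<Rightarrow>
   ((real ^ 'd) \<times> 'm \<Rightarrow> ((real ^ 'd) \<times> 'm) set \<Rightarrow> real) \<Rightarrow> bool" where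
  "papangelou_intensity \<mu> \<Gamma> \<kappa> \<longleftrightarrow>
     case_prod \<kappa> \<in> borel_measurable (borel \<Otimes>\<^sub>M config_space) \<and>
     (AE \<gamma> in \<Gamma>. AE z in lborel \<Otimes>\<^sub>M \<mu>. 0 \<le> \<kappa> z \<gamma>) \<and>
     (\<forall>f :: (real ^ 'd) \<times> 'm \<Rightarrow> ((real ^ 'd) \<times> 'm) set \<Rightarrow> real.
        case_prod f \<in> borel_measurable (borel \<Otimes>\<^sub>M config_space) \<longrightarrow> (\<forall>z \<gamma>. 0 \<le> f z \<gamma>) \<longrightarrow>
        (\<integral>\<^sup>+ \<gamma>. (\<integral>\<^sup>+ z. ennreal (f z (\<gamma> - {z})) \<partial>count_space \<gamma>) \<partial>\<Gamma>) =
        (\<integral>\<^sup>+ \<gamma>. (\<integral>\<^sup>+ z. ennreal (f z \<gamma> * \<kappa> z \<gamma>) \<partial>(lborel \<Otimes>\<^sub>M \<mu>)) \<partial>\<Gamma>))"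

definition num_points :: "(real ^ 'd) set \<Rightarrow> ((real ^ 'd) \<times> 'm) set \<Rightarrow> real" where
  "num_points \<Lambda> \<gamma> = real (card (\<gamma> \<inter> \<Lambda> \<times> UNIV))"

(* Variance with values in [0, \<infinity>]. On a probability space it agrees with prob_space.variance if
   X is square integrable, and it is \<infinity> otherwise (prob_space.variance may then be 0). *)
definition ext_variance :: "'a measure \<Rightarrow> ('a \<Rightarrow> real) \<Rightarrow> ennreal" where
  "ext_variance M X = (\<integral>\<^sup>+ \<omega>. ennreal ((X \<omega> - integral\<^sup>L M X)\<^sup>2) \<partial>M)"

definition hyperuniform :: "((real ^ 'd) \<times> 'm::polish_space) set measure \<Rightarrow> bool" where
  "hyperuniform \<Gamma> \<longleftrightarrow>
     (\<forall>\<Lambda> :: nat \<Rightarrow> (real ^ 'd) set.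
        incseq \<Lambda> \<longrightarrow> (\<Union>n. \<Lambda> n) = UNIV \<longrightarrow> (\<forall>n. bounded (\<Lambda> n) \<and> \<Lambda> n \<in> sets borel) \<longrightarrow>
        (\<lambda>n. ext_variance \<Gamma> (num_points (\<Lambda> n)) / emeasure lborel (\<Lambda> n)) \<longlonglongrightarrow> 0)"

end

theory Submission
  imports Defs
begin

text \<open>Let \<open>N\<close> be the number of points with location in a bounded window \<open>\<Lambda>\<close>. A lower bound on its variance
  follows, by Cauchy-Schwarz, from any other random variable whose covariance with \<open>N\<close> is at least of
  order \<open>|\<Lambda>|\<close> and whose variance is at most of that order. The Gibbs identity supplies such a variable.
  For a set \<open>A\<close> of marks, let \<open>S\<close> be the number of points in \<open>B = \<Lambda> \<times> A\<close> and let
  \<open>T = \<integral>\<^sub>B \<lambda>\<^sup>*(z, \<gamma>) dz\<close> be its compensator. Then, for functionals \<open>H\<close>,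

  \<open>E [S H] = E \<integral>\<^sub>B H(\<gamma> \<union> {z}) \<lambda>\<^sup>*(z, \<gamma>) dz\<close>, so
  \<open>E [(S - T) H] = E \<integral>\<^sub>B (H(\<gamma> \<union> {z}) - H(\<gamma>)) \<lambda>\<^sup>*(z, \<gamma>) dz\<close>.

  Adding a point of \<open>B\<close> raises \<open>N\<close> by one, so the covariance of \<open>N\<close> and \<open>S - T\<close> is \<open>E T\<close>, which by
  stationarity is \<open>\<rho> |\<Lambda>|\<close>, where \<open>\<rho>\<close> is the mean number of points with mark in \<open>A\<close> per unit volume
  (\<open>count_product_mean\<close>, \<open>compensator_mean\<close>). Applied to \<open>H = S - T\<close> the identity gives

  \<open>E (S - T)\<^sup>2 = E T + E \<integral>\<^sub>B \<integral>\<^sub>B \<lambda>\<^sup>*(z, \<gamma>) (\<lambda>\<^sup>*(y, \<gamma>) - \<lambda>\<^sup>*(y, \<gamma> \<union> {z})) dy dz\<close>.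

  The bracket is at most \<open>\<lambda>\<^sup>*(y, \<gamma>)\<close> always, and at most \<open>\<phi>(y - z) \<lambda>\<^sup>*(y, \<gamma>)\<close> when the locations are more
  than \<open>\<delta>\<close> apart. As \<open>\<phi>\<close> is integrable away from the origin, and second moments of the intensity are
  bounded for marks in \<open>A\<close>, the double integral is at most \<open>c |\<Lambda>|\<close> (\<open>compensator_square_mean_le\<close>,
  \<open>interaction_mean_le\<close>). Hence the variance of \<open>N\<close> is at least \<open>\<rho>\<^sup>2 |\<Lambda>| / (\<rho> + c)\<close>
  (\<open>variance_lower_bound\<close>).

  The set \<open>A\<close> enters because the second moments are finite for each mark without being bounded over
  the marks; a set \<open>A\<close> on which they are bounded and \<open>\<rho> > 0\<close> exists since the process is not almost
  surely empty (\<open>exists_mark_set\<close>). Expectations are taken in \<open>[0, \<infinity>]\<close> and identities between them are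
  written as sums, because at first none of the moments of \<open>N\<close> is known to be finite; subtraction
  happens only in \<open>variance_lower_bound\<close>, after the case of infinite variance has been separated.\<close>

section \<open>Measurability on the space of configurations\<close>

definition point_count :: "((real ^ 'd) \<times> 'm) set \<Rightarrow> ((real ^ 'd) \<times> 'm) set \<Rightarrow> ennreal" where
  "point_count A \<gamma> = emeasure (count_space UNIV) (\<gamma> \<inter> A)"

lemma space_config_space: "space config_space = configs"
  unfolding config_space_def by (subst space_Sup_eq_UN) auto

lemma measurable_point_count [measurable]:
  assumes "A \<in> sets borel"
  shows "point_count A \<in> borel_measurable config_space"
  unfolding config_space_def point_count_def
  by (rule measurable_SUP1[OF assms]) (auto intro: measurable_vimage_algebra1)

text \<open>The \<open>\<sigma>\<close>-algebra is generated by the counts, so a map into configurations is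
  measurable as soon as every count of its values is.\<close>

lemma measurable_config_spaceI:
  assumes "\<And>x. x \<in> space M \<Longrightarrow> f x \<in> configs"
    and "\<And>A. A \<in> sets borel \<Longrightarrow> (\<lambda>x. point_count A (f x)) \<in> borel_measurable M"
  shows "f \<in> M \<rightarrow>\<^sub>M config_space"
  unfolding config_space_def
proof (rule measurable_SUP2)
  show "sets borel \<noteq> {}" by blast
qed (use assms in \<open>auto intro!: measurable_vimage_algebra2 simp: point_count_def\<close>)

lemma sum_over_config:
  "(\<integral>\<^sup>+ z. indicator B z * c \<partial>count_space \<gamma>) = point_count B \<gamma> * c"
proof -
  have "(\<integral>\<^sup>+ z. indicator B z * c \<partial>count_space \<gamma>)
      = (\<integral>\<^sup>+ z. c * indicator (\<gamma> \<inter> B) z \<partial>count_space \<gamma>)"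
    by (rule nn_integral_cong) (auto simp: indicator_def)
  also have "\<dots> = c * emeasure (count_space \<gamma>) (\<gamma> \<inter> B)"
    by (rule nn_integral_cmult_indicator) auto
  also have "emeasure (count_space \<gamma>) (\<gamma> \<inter> B) = point_count B \<gamma>"
    by (auto simp: point_count_def emeasure_count_space)
  finally show ?thesis by (simp add: mult.commute)
qed

lemma translate_inverse: "translate u (translate (-u) z) = z" "translate (-u) (translate u z) = z"
  by (auto simp: translate_def split: prod.split)

lemma inj_translate: "inj (translate u)"
  by (metis injI translate_inverse(2))

lemma measurable_translate [measurable]:
  "translate u \<in> borel_measurable (borel :: ((real ^ 'd) \<times> 'm::polish_space) measure)"
  unfolding translate_def case_prod_unfold
  by (intro borel_measurable_continuous_onI continuous_intros)

lemma translate_image_in_configs: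
  fixes \<gamma> :: "((real ^ 'd) \<times> 'm) set"
  assumes "\<gamma> \<in> configs"
  shows "translate u ` \<gamma> \<in> configs"
  unfolding configs_def mem_Collect_eq
proof (intro allI impI)
  fix \<Lambda> :: "(real ^ 'd) set" assume "bounded \<Lambda>"
  then have "bounded ((\<lambda>x. -u + x) ` \<Lambda>)" by (rule bounded_translation)
  then have "finite (\<gamma> \<inter> ((\<lambda>x. -u + x) ` \<Lambda>) \<times> UNIV)"
    using assms by (auto simp: configs_def)
  then have "finite (translate u ` (\<gamma> \<inter> ((\<lambda>x. -u + x) ` \<Lambda>) \<times> UNIV))" by (rule finite_imageI)
  then show "finite (translate u ` \<gamma> \<inter> \<Lambda> \<times> UNIV)"
    by (rule rev_finite_subset) (force simp: translate_def image_iff)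
qed

lemma measurable_translate_image [measurable]:
  "(\<lambda>\<gamma>. translate u ` \<gamma>) \<in>
     (config_space :: ((real ^ 'd) \<times> 'm::polish_space) set measure) \<rightarrow>\<^sub>M config_space"
proof (rule measurable_config_spaceI)
  fix A :: "((real ^ 'd) \<times> 'm) set" assume A: "A \<in> sets borel"
  have "translate u -` A \<in> sets borel"
    using measurable_sets[OF measurable_translate A, of u] by simp
  moreover have "point_count A (translate u ` \<gamma>) = point_count (translate u -` A) \<gamma>" for \<gamma>
  proof -
    have "translate u ` \<gamma> \<inter> A = translate u ` (\<gamma> \<inter> translate u -` A)" by auto
    then show ?thesis
      using inj_on_subset[OF inj_translate[of u] subset_UNIV[of "\<gamma> \<inter> translate u -` A"]]
      by (simp add: point_count_def emeasure_count_space finite_image_iff card_image)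
  qed
  ultimately show "(\<lambda>\<gamma>. point_count A (translate u ` \<gamma>)) \<in> borel_measurable config_space"
    by simp
qed (simp add: space_config_space translate_image_in_configs)

lemma finite_window:
  assumes "\<gamma> \<in> configs" "bounded \<Lambda>" "B \<subseteq> \<Lambda> \<times> UNIV"
  shows "finite (\<gamma> \<inter> B)"
  using assms by (auto simp: configs_def intro: finite_subset[of _ "\<gamma> \<inter> \<Lambda> \<times> UNIV"])

text \<open>Marks carry no finiteness of their own, but a point of the product space has a
  neighbourhood lying over a bounded set of locations, and a finite set can be removed from it.
  Closedness is what makes membership measurable below.\<close>

lemma closed_config:
  fixes \<gamma> :: "((real ^ 'd) \<times> 'm::polish_space) set"
  assumes "\<gamma> \<in> configs"
  shows "closed \<gamma>"
proof -
  have "\<exists>U. open U \<and> z \<in> U \<and> U \<subseteq> - \<gamma>" if z: "z \<in> - \<gamma>" for z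
  proof (intro exI conjI)
    let ?F = "\<gamma> \<inter> ball (fst z) 1 \<times> UNIV"
    have "finite ?F" by (rule finite_window[OF assms bounded_ball order_refl])
    then show "open (ball (fst z) 1 \<times> UNIV - ?F)"
      by (intro open_Diff open_Times finite_imp_closed) auto
    show "z \<in> ball (fst z) 1 \<times> UNIV - ?F" using z by (auto simp: mem_Times_iff)
    show "ball (fst z) 1 \<times> UNIV - ?F \<subseteq> - \<gamma>" by auto
  qed
  then show ?thesis
    unfolding closed_def by (subst open_subopen) blast
qed

text \<open>A closed set contains \<open>z\<close> iff it meets every basic open neighbourhood of \<open>z\<close>; with a
  countable basis this turns membership into countably many conditions on counts.\<close>

lemma measurable_config_member [measurable]:
  "Measurable.pred (borel \<Otimes>\<^sub>M config_space)
     (\<lambda>(z :: (real ^ 'd) \<times> 'm::polish_space, \<gamma>). z \<in> \<gamma>)"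
proof -
  obtain \<B> :: "((real ^ 'd) \<times> 'm) set set" where \<B>: "countable \<B>" "topological_basis \<B>"
    using ex_countable_basis by auto
  have borel: "B \<in> sets borel" if "B \<in> \<B>" for B
    using topological_basis_open[OF \<B>(2) that] by simp
  have *: "z \<in> \<gamma> \<longleftrightarrow> (\<forall>B\<in>\<B>. z \<in> B \<longrightarrow> point_count B \<gamma> \<noteq> 0)" if \<gamma>: "\<gamma> \<in> configs" for z \<gamma>
  proof
    assume *: "\<forall>B\<in>\<B>. z \<in> B \<longrightarrow> point_count B \<gamma> \<noteq> 0"
    show "z \<in> \<gamma>"
    proof (rule ccontr)
      assume "z \<notin> \<gamma>"
      then obtain B where "B \<in> \<B>" "z \<in> B" "B \<subseteq> - \<gamma>"
        using topological_basisE[OF \<B>(2), of "- \<gamma>" z] closed_config[OF \<gamma>] by auto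
      moreover from this have "\<gamma> \<inter> B = {}" by auto
      ultimately show False using * by (auto simp: point_count_def)
    qed
  qed (auto simp: point_count_def emeasure_count_space_eq_0)
  have "Measurable.pred (borel \<Otimes>\<^sub>M config_space)
      (\<lambda>p. \<forall>B\<in>\<B>. fst p \<in> B \<longrightarrow> point_count B (snd p) \<noteq> 0)"
    unfolding pred_def
    by (rule sets.sets_Collect_countable_All'[OF _ \<B>(1)], unfold pred_def[symmetric])
      (use borel in measurable)
  moreover have "?thesis \<longleftrightarrow> Measurable.pred (borel \<Otimes>\<^sub>M config_space)
      (\<lambda>p. \<forall>B\<in>\<B>. fst p \<in> B \<longrightarrow> point_count B (snd p) \<noteq> 0)"
    by (rule measurable_cong) (auto simp: space_pair_measure space_config_space *)
  ultimately show ?thesis by simp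
qed

lemma config_countable:
  fixes \<gamma> :: "((real ^ 'd) \<times> 'm) set"
  assumes "\<gamma> \<in> configs"
  shows "countable \<gamma>"
proof -
  have "\<gamma> = (\<Union>n::nat. \<gamma> \<inter> ball 0 (real n) \<times> UNIV)"
  proof -
    have "\<exists>n::nat. norm x < real n" for x :: "real ^ 'd" by (rule reals_Archimedean2)
    then show ?thesis by fastforce
  qed
  moreover have "finite (\<gamma> \<inter> ball 0 (real n) \<times> UNIV)" for n :: nat
    by (rule finite_window[OF assms bounded_ball order_refl])
  ultimately show ?thesis by (metis countable_UN countable_finite countableI_type)
qed

lemma insert_in_configs:
  assumes "\<gamma> \<in> configs"
  shows "insert z \<gamma> \<in> configs"
  using assms by (auto simp: configs_def Int_insert_left)

lemma point_count_insert:
  "point_count A (insert z \<gamma>) = point_count A \<gamma> + (if z \<in> \<gamma> then 0 else indicator A z)"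
  by (auto simp: point_count_def emeasure_count_space insert_absorb Int_insert_left indicator_def
        card_insert_if)

text \<open>Inserting \<open>z\<close> changes the count of \<open>A\<close> only if \<open>z\<close> was absent, which is why joint
  measurability of membership is needed here.\<close>

lemma measurable_insert_config [measurable]:
  "(\<lambda>(z, \<gamma>). insert z \<gamma>) \<in>
     (borel :: ((real ^ 'd) \<times> 'm::polish_space) measure) \<Otimes>\<^sub>M config_space \<rightarrow>\<^sub>M config_space"
proof (rule measurable_config_spaceI)
  fix A :: "((real ^ 'd) \<times> 'm) set" assume [measurable]: "A \<in> sets borel"
  have "(\<lambda>p. point_count A (snd p) +
      (if case_prod (\<in>) p then 0 else indicator A (fst p)))
      \<in> borel_measurable (borel \<Otimes>\<^sub>M config_space)"
    by measurable
  then show "(\<lambda>p. point_count A (case p of (z, \<gamma>) \<Rightarrow> insert z \<gamma>))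
      \<in> borel_measurable (borel \<Otimes>\<^sub>M config_space)"
    by (simp add: point_count_insert case_prod_unfold)
qed (auto simp: space_pair_measure space_config_space insert_in_configs)

section \<open>Moments of counts and compensators\<close>

locale gibbs_process =
  fixes \<mu> :: "'m::polish_space measure"
    and \<Gamma> :: "((real ^ 'd) \<times> 'm) set measure"
    and \<kappa> :: "(real ^ 'd) \<times> 'm \<Rightarrow> ((real ^ 'd) \<times> 'm) set \<Rightarrow> real"
  assumes finite_marks: "finite_measure \<mu>"
    and sets_marks [measurable_cong]: "sets \<mu> = sets borel"
    and process: "point_process \<Gamma>"
    and gibbs: "papangelou_intensity \<mu> \<Gamma> \<kappa>"
begin

sublocale prob_space \<Gamma>
  using process by (simp add: point_process_def)

sublocale marks: finite_measure \<mu>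
  by (rule finite_marks)

sublocale ref: pair_sigma_finite "lborel :: (real ^ 'd) measure" \<mu>
  by unfold_locales

abbreviation \<nu> :: "((real ^ 'd) \<times> 'm) measure" where
  "\<nu> \<equiv> lborel \<Otimes>\<^sub>M \<mu>"

sublocale two: pair_sigma_finite \<nu> \<Gamma>
  by unfold_locales

text \<open>The positive part of the Papangelou intensity, as a value in \<open>[0, \<infinity>]\<close>. The bound on
  intensity ratios survives this truncation as a one-sided inequality valid for every configuration
  (\<open>ennreal_le_of_ratio_bound\<close>), and the second moment can only decrease.\<close>

definition intensity :: "(real ^ 'd) \<times> 'm \<Rightarrow> ((real ^ 'd) \<times> 'm) set \<Rightarrow> ennreal" where
  "intensity z \<gamma> = ennreal (\<kappa> z \<gamma>)"

text \<open>Heuristically the predicted number of points in \<open>B\<close> given the configuration: count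
  and compensator have the same mean, by \<open>count_compensator_mean\<close> below.\<close>

definition compensator :: "((real ^ 'd) \<times> 'm) set \<Rightarrow> ((real ^ 'd) \<times> 'm) set \<Rightarrow> ennreal" where
  "compensator B \<gamma> = (\<integral>\<^sup>+ z. indicator B z * intensity z \<gamma> \<partial>\<nu>)"

lemma sets_process [measurable_cong]: "sets \<Gamma> = sets config_space"
  using process by (simp add: point_process_def)

lemma space_process: "space \<Gamma> = configs"
  using sets_eq_imp_space_eq[OF sets_process] by (simp add: space_config_space)

lemma sets_ref [measurable_cong]: "sets \<nu> = sets borel"
proof -
  have "sets \<nu> = sets ((borel :: (real ^ 'd) measure) \<Otimes>\<^sub>M (borel :: 'm measure))"
    by (rule sets_pair_measure_cong) (simp_all add: sets_marks)
  then show ?thesis unfolding borel_prod .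
qed

lemma measurable_location [measurable]: "fst \<in> borel_measurable (borel :: ((real ^ 'd) \<times> 'm) measure)"
  by (intro borel_measurable_continuous_onI continuous_intros)

lemma measurable_intensity [measurable]:
  "case_prod intensity \<in> borel_measurable (borel \<Otimes>\<^sub>M config_space)"
  using gibbs unfolding papangelou_intensity_def intensity_def[abs_def] case_prod_unfold
  by (auto intro: measurable_compose[OF _ measurable_ennreal])

lemma measurable_compensator [measurable]:
  assumes [measurable]: "B \<in> sets borel"
  shows "compensator B \<in> borel_measurable config_space"
  unfolding compensator_def[abs_def] by measurable

text \<open>The Gibbs identity for \<open>f(z, \<gamma>) = 1\<^sub>B(z) H(\<gamma> \<union> {z})\<close>: on the left, removing and
  reinserting a point of \<open>\<gamma>\<close> gives \<open>H(\<gamma>)\<close> back. The identity is given for real \<open>f\<close>, whereas \<open>H\<close>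
  will be a compensator, which may be infinite; hence truncation and monotone convergence.\<close>

lemma count_times_functional:
  assumes [measurable]: "B \<in> sets borel" "H \<in> borel_measurable config_space"
  shows "(\<integral>\<^sup>+ \<gamma>. point_count B \<gamma> * H \<gamma> \<partial>\<Gamma>) =
    (\<integral>\<^sup>+ \<gamma>. (\<integral>\<^sup>+ z. indicator B z * intensity z \<gamma> * H (insert z \<gamma>) \<partial>\<nu>) \<partial>\<Gamma>)"
proof -
  define Hn where "Hn n \<gamma> = min (H \<gamma>) (ennreal (real n))" for n :: nat and \<gamma>
  have Hn_meas [measurable]: "Hn n \<in> borel_measurable config_space" for n
    unfolding Hn_def[abs_def] by measurable
  have Hn_finite: "Hn n \<gamma> < top" for n \<gamma>
    by (simp add: Hn_def min_less_iff_disj)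
  have Hn_mono: "Hn m \<gamma> \<le> Hn n \<gamma>" if "m \<le> n" for m n \<gamma>
    unfolding Hn_def using that by (intro min.mono ennreal_leI) auto
  have Hn_SUP: "(SUP n. Hn n \<gamma>) = H \<gamma>" for \<gamma>
  proof -
    have "(SUP n. Hn n \<gamma>) = inf (H \<gamma>) (SUP n. ennreal (real n))"
      by (simp only: Hn_def inf_SUP inf_min[symmetric])
    also have "(SUP n. ennreal (real n)) = (top :: ennreal)"
      using ennreal_SUP_of_nat_eq_top by (simp add: ennreal_of_nat_eq_real_of_nat)
    finally show ?thesis by simp
  qed
  have bounded_case: "(\<integral>\<^sup>+ \<gamma>. point_count B \<gamma> * Hn n \<gamma> \<partial>\<Gamma>) =
      (\<integral>\<^sup>+ \<gamma>. (\<integral>\<^sup>+ z. indicator B z * intensity z \<gamma> * Hn n (insert z \<gamma>) \<partial>\<nu>) \<partial>\<Gamma>)" for n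
  proof -
    let ?f = "\<lambda>z \<gamma>. indicator B z * enn2real (Hn n (insert z \<gamma>))"
    have "case_prod ?f \<in> borel_measurable (borel \<Otimes>\<^sub>M config_space)"
      by measurable
    moreover have "\<forall>z \<gamma>. 0 \<le> ?f z \<gamma>" by simp
    ultimately have *: "(\<integral>\<^sup>+ \<gamma>. (\<integral>\<^sup>+ z. ennreal (?f z (\<gamma> - {z})) \<partial>count_space \<gamma>) \<partial>\<Gamma>) =
        (\<integral>\<^sup>+ \<gamma>. (\<integral>\<^sup>+ z. ennreal (?f z \<gamma> * \<kappa> z \<gamma>) \<partial>\<nu>) \<partial>\<Gamma>)"
      using gibbs unfolding papangelou_intensity_def by blast
    have "(\<integral>\<^sup>+ z. ennreal (?f z (\<gamma> - {z})) \<partial>count_space \<gamma>) = point_count B \<gamma> * Hn n \<gamma>" for \<gamma>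
      unfolding sum_over_config[symmetric]
      by (rule nn_integral_cong)
        (auto simp: ennreal_mult Hn_finite insert_absorb ennreal_indicator)
    moreover have "ennreal (?f z \<gamma> * \<kappa> z \<gamma>) =
        indicator B z * intensity z \<gamma> * Hn n (insert z \<gamma>)" for z \<gamma>
      using Hn_finite[of n "insert z \<gamma>"]
      by (auto simp: ennreal_mult'' intensity_def indicator_def mult.commute)
    ultimately show ?thesis using * by simp
  qed
  have "(\<integral>\<^sup>+ \<gamma>. point_count B \<gamma> * H \<gamma> \<partial>\<Gamma>) =
      (\<integral>\<^sup>+ \<gamma>. (SUP n. point_count B \<gamma> * Hn n \<gamma>) \<partial>\<Gamma>)"
    by (simp add: SUP_mult_left_ennreal[symmetric] Hn_SUP)
  also have "\<dots> = (SUP n. \<integral>\<^sup>+ \<gamma>. point_count B \<gamma> * Hn n \<gamma> \<partial>\<Gamma>)"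
    by (rule nn_integral_monotone_convergence_SUP)
      (auto simp: incseq_def le_fun_def intro!: mult_left_mono Hn_mono)
  also have "\<dots> = (SUP n. \<integral>\<^sup>+ \<gamma>. (\<integral>\<^sup>+ z. indicator B z * intensity z \<gamma> * Hn n (insert z \<gamma>) \<partial>\<nu>) \<partial>\<Gamma>)"
    by (simp only: bounded_case)
  also have "\<dots> = (\<integral>\<^sup>+ \<gamma>. (SUP n. \<integral>\<^sup>+ z. indicator B z * intensity z \<gamma> * Hn n (insert z \<gamma>) \<partial>\<nu>) \<partial>\<Gamma>)"
    by (rule nn_integral_monotone_convergence_SUP[symmetric])
      (auto simp: incseq_def le_fun_def intro!: nn_integral_mono mult_left_mono Hn_mono)
  also have "\<dots> = (\<integral>\<^sup>+ \<gamma>. (\<integral>\<^sup>+ z. (SUP n. indicator B z * intensity z \<gamma> * Hn n (insert z \<gamma>)) \<partial>\<nu>) \<partial>\<Gamma>)"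
  proof (rule nn_integral_cong)
    fix \<gamma> assume "\<gamma> \<in> space \<Gamma>"
    then have [measurable]: "\<gamma> \<in> space config_space"
      by (simp add: space_process space_config_space)
    show "(SUP n. \<integral>\<^sup>+ z. indicator B z * intensity z \<gamma> * Hn n (insert z \<gamma>) \<partial>\<nu>) =
        (\<integral>\<^sup>+ z. (SUP n. indicator B z * intensity z \<gamma> * Hn n (insert z \<gamma>)) \<partial>\<nu>)"
      by (rule nn_integral_monotone_convergence_SUP[symmetric])
        (auto simp: incseq_def le_fun_def intro!: mult_left_mono Hn_mono)
  qed
  finally show ?thesis
    by (simp add: SUP_mult_left_ennreal[symmetric] Hn_SUP)
qed

lemma count_compensator_mean:
  assumes [measurable]: "B \<in> sets borel"
  shows "(\<integral>\<^sup>+ \<gamma>. point_count B \<gamma> \<partial>\<Gamma>) = (\<integral>\<^sup>+ \<gamma>. compensator B \<gamma> \<partial>\<Gamma>)"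
  using count_times_functional[of B "\<lambda>_. 1"] by (simp add: compensator_def)

text \<open>The locations of a configuration are countable, hence a Lebesgue null set, whatever the marks.\<close>

lemma AE_not_in_config:
  assumes "\<gamma> \<in> configs"
  shows "AE z in \<nu>. z \<notin> \<gamma>"
proof -
  have "countable (fst ` \<gamma>)" using config_countable[OF assms] by simp
  then have null: "fst ` \<gamma> \<in> null_sets lborel" by (rule countable_imp_null_set_lborel)
  then have "emeasure \<nu> (fst ` \<gamma> \<times> space \<mu>) = 0"
    by (subst marks.emeasure_pair_measure_Times) auto
  moreover have "fst ` \<gamma> \<times> space \<mu> \<in> sets \<nu>" using null by auto
  ultimately have "fst ` \<gamma> \<times> space \<mu> \<in> null_sets \<nu>" by auto
  then show ?thesis
    by (rule AE_I') (auto simp: sets_eq_imp_space_eq[OF sets_marks] space_pair_measure image_iff, force)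
qed

text \<open>Almost every \<open>z \<in> B\<close> is a new point, so inserting it raises the count of \<open>W \<supseteq> B\<close> by exactly
  one; the second summand on the right is this increment. For \<open>W\<close> the full window this is the
  covariance of its count with the compensated count of \<open>B\<close>, for \<open>W = B\<close> it gives the second
  moment of the count of \<open>B\<close>.\<close>

lemma count_product_mean:
  assumes [measurable]: "B \<in> sets borel" "W \<in> sets borel" and "B \<subseteq> W"
  shows "(\<integral>\<^sup>+ \<gamma>. point_count B \<gamma> * point_count W \<gamma> \<partial>\<Gamma>) =
    (\<integral>\<^sup>+ \<gamma>. compensator B \<gamma> * point_count W \<gamma> \<partial>\<Gamma>) + (\<integral>\<^sup>+ \<gamma>. compensator B \<gamma> \<partial>\<Gamma>)"
proof -
  have "(\<integral>\<^sup>+ z. indicator B z * intensity z \<gamma> * point_count W (insert z \<gamma>) \<partial>\<nu>) =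
      compensator B \<gamma> * point_count W \<gamma> + compensator B \<gamma>" if "\<gamma> \<in> configs" for \<gamma>
  proof -
    have [measurable]: "\<gamma> \<in> space config_space"
      using that by (simp add: space_config_space)
    have "(\<integral>\<^sup>+ z. indicator B z * intensity z \<gamma> * point_count W (insert z \<gamma>) \<partial>\<nu>) =
        (\<integral>\<^sup>+ z. indicator B z * intensity z \<gamma> * point_count W \<gamma> + indicator B z * intensity z \<gamma> \<partial>\<nu>)"
      using AE_not_in_config[OF that] \<open>B \<subseteq> W\<close>
      by (intro nn_integral_cong_AE)
        (auto elim!: eventually_mono simp: point_count_insert indicator_def distrib_left)
    also have "\<dots> = compensator B \<gamma> * point_count W \<gamma> + compensator B \<gamma>"
      by (subst nn_integral_add) (auto simp: compensator_def nn_integral_multc)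
    finally show ?thesis .
  qed
  then have "(\<integral>\<^sup>+ \<gamma>. point_count B \<gamma> * point_count W \<gamma> \<partial>\<Gamma>) =
      (\<integral>\<^sup>+ \<gamma>. compensator B \<gamma> * point_count W \<gamma> + compensator B \<gamma> \<partial>\<Gamma>)"
    by (subst count_times_functional) (auto intro!: nn_integral_cong simp: space_process)
  also have "\<dots> = (\<integral>\<^sup>+ \<gamma>. compensator B \<gamma> * point_count W \<gamma> \<partial>\<Gamma>) + (\<integral>\<^sup>+ \<gamma>. compensator B \<gamma> \<partial>\<Gamma>)"
    by (rule nn_integral_add) measurable
  finally show ?thesis .
qed

text \<open>The mean of count times compensator is the mean of
  \<open>\<integral>\<^sub>B \<lambda>\<^sup>*(z, \<gamma>) compensator(\<gamma> \<union> {z}) dz\<close>, so it differs from the mean squared compensator by the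
  effect of one point on the intensity elsewhere. The assumption bounds this effect relative to the
  intensity by \<open>g\<close>. Moving both differences to the other side as sums avoids truncated subtraction
  and any question of finiteness.\<close>

lemma compensator_square_mean_le:
  fixes g :: "real ^ 'd \<Rightarrow> ennreal"
  assumes B [measurable]: "B \<in> sets borel" and g [measurable]: "g \<in> borel_measurable borel"
    and interaction: "\<And>z y \<gamma>. \<gamma> \<in> configs \<Longrightarrow>
      intensity y \<gamma> \<le> intensity y (insert z \<gamma>) + intensity y \<gamma> * g (fst y - fst z)"
  shows "(\<integral>\<^sup>+ \<gamma>. compensator B \<gamma> * compensator B \<gamma> \<partial>\<Gamma>) \<le>
    (\<integral>\<^sup>+ \<gamma>. point_count B \<gamma> * compensator B \<gamma> \<partial>\<Gamma>) +
    (\<integral>\<^sup>+ \<gamma>. (\<integral>\<^sup>+ z. (\<integral>\<^sup>+ y. indicator B z * intensity z \<gamma> *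
       (indicator B y * intensity y \<gamma> * g (fst y - fst z)) \<partial>\<nu>) \<partial>\<nu>) \<partial>\<Gamma>)"
proof -
  let ?R = "\<lambda>\<gamma> z. \<integral>\<^sup>+ y. indicator B z * intensity z \<gamma> *
       (indicator B y * intensity y \<gamma> * g (fst y - fst z)) \<partial>\<nu>"
  have split: "compensator B \<gamma> * compensator B \<gamma> \<le>
      (\<integral>\<^sup>+ z. indicator B z * intensity z \<gamma> * compensator B (insert z \<gamma>) \<partial>\<nu>) + (\<integral>\<^sup>+ z. ?R \<gamma> z \<partial>\<nu>)"
    if \<gamma>: "\<gamma> \<in> configs" for \<gamma>
  proof -
    have [measurable]: "\<gamma> \<in> space config_space"
      using \<gamma> by (simp add: space_config_space)
    have pointwise: "compensator B \<gamma> \<le> compensator B (insert z \<gamma>) +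
        (\<integral>\<^sup>+ y. indicator B y * intensity y \<gamma> * g (fst y - fst z) \<partial>\<nu>)" for z
    proof -
      have [measurable]: "insert z \<gamma> \<in> space config_space"
        using \<gamma> by (simp add: space_config_space insert_in_configs)
      have 1: "(\<lambda>y. indicator B y * intensity y (insert z \<gamma>)) \<in> borel_measurable \<nu>"
        by measurable
      have 2: "(\<lambda>y. indicator B y * intensity y \<gamma> * g (fst y - fst z)) \<in> borel_measurable \<nu>"
        by measurable
      have "compensator B \<gamma> \<le> (\<integral>\<^sup>+ y. indicator B y * intensity y (insert z \<gamma>) +
          indicator B y * intensity y \<gamma> * g (fst y - fst z) \<partial>\<nu>)"
        unfolding compensator_def
        by (rule nn_integral_mono) (auto simp: indicator_def interaction[OF \<gamma>])
      also have "\<dots> = compensator B (insert z \<gamma>) +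
          (\<integral>\<^sup>+ y. indicator B y * intensity y \<gamma> * g (fst y - fst z) \<partial>\<nu>)"
        unfolding compensator_def by (rule nn_integral_add[OF 1 2])
      finally show ?thesis .
    qed
    have "compensator B \<gamma> * compensator B \<gamma> =
        (\<integral>\<^sup>+ z. indicator B z * intensity z \<gamma> * compensator B \<gamma> \<partial>\<nu>)"
      by (subst nn_integral_multc) (auto simp: compensator_def)
    also have "\<dots> \<le> (\<integral>\<^sup>+ z. indicator B z * intensity z \<gamma> * compensator B (insert z \<gamma>) + ?R \<gamma> z \<partial>\<nu>)"
    proof (rule nn_integral_mono)
      fix z
      have "?R \<gamma> z = indicator B z * intensity z \<gamma> *
          (\<integral>\<^sup>+ y. indicator B y * intensity y \<gamma> * g (fst y - fst z) \<partial>\<nu>)"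
        by (rule nn_integral_cmult) measurable
      then show "indicator B z * intensity z \<gamma> * compensator B \<gamma> \<le>
          indicator B z * intensity z \<gamma> * compensator B (insert z \<gamma>) + ?R \<gamma> z"
        using mult_left_mono[OF pointwise, of "indicator B z * intensity z \<gamma>" z]
        by (simp add: distrib_left)
    qed
    also have "\<dots> = (\<integral>\<^sup>+ z. indicator B z * intensity z \<gamma> * compensator B (insert z \<gamma>) \<partial>\<nu>) +
        (\<integral>\<^sup>+ z. ?R \<gamma> z \<partial>\<nu>)"
      by (rule nn_integral_add) measurable
    finally show ?thesis .
  qed
  have "(\<integral>\<^sup>+ \<gamma>. compensator B \<gamma> * compensator B \<gamma> \<partial>\<Gamma>) \<le>
      (\<integral>\<^sup>+ \<gamma>. (\<integral>\<^sup>+ z. indicator B z * intensity z \<gamma> * compensator B (insert z \<gamma>) \<partial>\<nu>) +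
        (\<integral>\<^sup>+ z. ?R \<gamma> z \<partial>\<nu>) \<partial>\<Gamma>)"
    by (rule nn_integral_mono) (simp add: space_process split)
  also have "\<dots> = (\<integral>\<^sup>+ \<gamma>. point_count B \<gamma> * compensator B \<gamma> \<partial>\<Gamma>) + (\<integral>\<^sup>+ \<gamma>. (\<integral>\<^sup>+ z. ?R \<gamma> z \<partial>\<nu>) \<partial>\<Gamma>)"
    by (subst nn_integral_add) (auto simp: count_times_functional)
  finally show ?thesis .
qed

end

section \<open>Stationarity and the interaction bound\<close>

locale stationary_gibbs_process = gibbs_process \<mu> \<Gamma> \<kappa>
  for \<mu> :: "'m::polish_space measure"
    and \<Gamma> :: "((real ^ 'd) \<times> 'm) set measure"
    and \<kappa> +
  assumes stationary: "stationary \<Gamma>"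
    and invariant: "\<And>u z \<gamma>. \<gamma> \<in> configs \<Longrightarrow> \<kappa> z \<gamma> = \<kappa> (translate u z) (translate u ` \<gamma>)"
begin

definition mean_intensity :: "'m \<Rightarrow> ennreal" where
  "mean_intensity m = (\<integral>\<^sup>+ \<gamma>. intensity (0, m) \<gamma> \<partial>\<Gamma>)"

definition square_intensity :: "'m \<Rightarrow> ennreal" where
  "square_intensity m = (\<integral>\<^sup>+ \<gamma>. (intensity (0, m) \<gamma>)\<^sup>2 \<partial>\<Gamma>)"

lemma measurable_intensity_at_mark [measurable]:
  "(\<lambda>(m, \<gamma>). intensity (0, m) \<gamma>) \<in> borel_measurable (borel \<Otimes>\<^sub>M config_space)"
proof -
  have [measurable]: "(\<lambda>m. (0, m)) \<in> borel \<rightarrow>\<^sub>M (borel :: ((real ^ 'd) \<times> 'm) measure)"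
    by (intro borel_measurable_continuous_onI continuous_intros)
  show ?thesis by measurable
qed

lemma measurable_mean_intensity [measurable]: "mean_intensity \<in> borel_measurable borel"
  unfolding mean_intensity_def[abs_def] by measurable

lemma measurable_square_intensity [measurable]: "square_intensity \<in> borel_measurable borel"
  unfolding square_intensity_def[abs_def] by measurable

lemma measurable_intensity_section [measurable]:
  "intensity z \<in> borel_measurable config_space"
  by measurable

lemma measurable_mark [measurable]: "snd \<in> borel_measurable (borel :: ((real ^ 'd) \<times> 'm) measure)"
  by (intro borel_measurable_continuous_onI continuous_intros)

text \<open>Translating the configuration by \<open>x\<close> preserves its law and turns the intensity at \<open>(x, m)\<close> into
  the one at \<open>(0, m)\<close>.\<close>

lemma expectation_at_origin:
  fixes F :: "ennreal \<Rightarrow> ennreal"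
  assumes [measurable]: "F \<in> borel_measurable borel"
  shows "(\<integral>\<^sup>+ \<gamma>. F (intensity (x, m) \<gamma>) \<partial>\<Gamma>) = (\<integral>\<^sup>+ \<gamma>. F (intensity (0, m) \<gamma>) \<partial>\<Gamma>)"
proof -
  have "(\<integral>\<^sup>+ \<gamma>. F (intensity (x, m) \<gamma>) \<partial>\<Gamma>) =
      (\<integral>\<^sup>+ \<gamma>. F (intensity (x, m) \<gamma>) \<partial>distr \<Gamma> config_space (\<lambda>\<gamma>. translate x ` \<gamma>))"
    using stationary by (simp add: stationary_def)
  also have "\<dots> = (\<integral>\<^sup>+ \<gamma>. F (intensity (x, m) (translate x ` \<gamma>)) \<partial>\<Gamma>)"
    by (rule nn_integral_distr) measurable
  also have "\<dots> = (\<integral>\<^sup>+ \<gamma>. F (intensity (0, m) \<gamma>) \<partial>\<Gamma>)"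
    using invariant[of _ "(0, m)" x]
    by (intro nn_integral_cong) (simp add: space_process intensity_def translate_def)
  finally show ?thesis .
qed

lemma window_in_borel [measurable]:
  assumes "\<Lambda> \<in> sets (borel :: (real ^ 'd) measure)" "A \<in> sets (borel :: 'm measure)"
  shows "\<Lambda> \<times> A \<in> sets borel"
  using pair_measureI[OF assms] unfolding borel_prod .

lemma nn_integral_window:
  assumes [measurable]: "\<Lambda> \<in> sets borel" "A \<in> sets borel" "f \<in> borel_measurable borel" "h \<in> borel_measurable borel"
  shows "(\<integral>\<^sup>+ z. indicator (\<Lambda> \<times> A) z * (f (fst z) * h (snd z)) \<partial>\<nu>) =
    (\<integral>\<^sup>+ x. indicator \<Lambda> x * f x \<partial>lborel) * (\<integral>\<^sup>+ m. indicator A m * h m \<partial>\<mu>)"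
proof -
  have "(\<integral>\<^sup>+ z. indicator (\<Lambda> \<times> A) z * (f (fst z) * h (snd z)) \<partial>\<nu>) =
      (\<integral>\<^sup>+ x. \<integral>\<^sup>+ m. (indicator \<Lambda> x * f x) * (indicator A m * h m) \<partial>\<mu> \<partial>lborel)"
    by (subst marks.nn_integral_fst[symmetric])
      (auto intro!: nn_integral_cong simp: indicator_def)
  then show ?thesis
    by (simp add: nn_integral_cmult nn_integral_multc)
qed

lemma compensator_mean:
  assumes [measurable]: "\<Lambda> \<in> sets borel" "A \<in> sets borel"
  shows "(\<integral>\<^sup>+ \<gamma>. compensator (\<Lambda> \<times> A) \<gamma> \<partial>\<Gamma>) =
    emeasure lborel \<Lambda> * (\<integral>\<^sup>+ m. indicator A m * mean_intensity m \<partial>\<mu>)"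
proof -
  have "(\<integral>\<^sup>+ \<gamma>. compensator (\<Lambda> \<times> A) \<gamma> \<partial>\<Gamma>) =
      (\<integral>\<^sup>+ z. \<integral>\<^sup>+ \<gamma>. indicator (\<Lambda> \<times> A) z * intensity z \<gamma> \<partial>\<Gamma> \<partial>\<nu>)"
    unfolding compensator_def by (rule two.Fubini') measurable
  also have "\<dots> = (\<integral>\<^sup>+ z. indicator (\<Lambda> \<times> A) z * (1 * mean_intensity (snd z)) \<partial>\<nu>)"
  proof (rule nn_integral_cong)
    fix z
    show "(\<integral>\<^sup>+ \<gamma>. indicator (\<Lambda> \<times> A) z * intensity z \<gamma> \<partial>\<Gamma>) =
        indicator (\<Lambda> \<times> A) z * (1 * mean_intensity (snd z))"
      using expectation_at_origin[of "\<lambda>t. t" "fst z" "snd z"]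
      by (simp add: nn_integral_cmult mean_intensity_def)
  qed
  also have "\<dots> = emeasure lborel \<Lambda> * (\<integral>\<^sup>+ m. indicator A m * mean_intensity m \<partial>\<mu>)"
    by (subst nn_integral_window) simp_all
  finally show ?thesis .
qed

text \<open>By \<open>a b \<le> a\<^sup>2 + b\<^sup>2\<close> the mixed moment at two locations is controlled by second moments, which
  stationarity moves to the origin.\<close>

lemma intensity_product_mean_le:
  assumes "square_intensity (snd z) \<le> K" "square_intensity (snd y) \<le> K"
  shows "(\<integral>\<^sup>+ \<gamma>. intensity z \<gamma> * intensity y \<gamma> \<partial>\<Gamma>) \<le> 2 * K"
proof -
  have "a * b \<le> a\<^sup>2 + b\<^sup>2" for a b :: ennreal
  proof (cases "a \<le> b")
    case True
    then have "a * b \<le> b\<^sup>2" by (simp add: power2_eq_square mult_right_mono)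
    then show ?thesis by (simp add: add_increasing)
  next
    case False
    then have "a * b \<le> a\<^sup>2" by (simp add: power2_eq_square mult_left_mono)
    then show ?thesis by (simp add: add_increasing2)
  qed
  then have "(\<integral>\<^sup>+ \<gamma>. intensity z \<gamma> * intensity y \<gamma> \<partial>\<Gamma>) \<le>
      (\<integral>\<^sup>+ \<gamma>. (intensity z \<gamma>)\<^sup>2 + (intensity y \<gamma>)\<^sup>2 \<partial>\<Gamma>)"
    by (intro nn_integral_mono)
  also have "\<dots> = square_intensity (snd z) + square_intensity (snd y)"
    using expectation_at_origin[of "\<lambda>t. t\<^sup>2" "fst z" "snd z"]
      expectation_at_origin[of "\<lambda>t. t\<^sup>2" "fst y" "snd y"]
    by (subst nn_integral_add) (auto simp: square_intensity_def)
  also have "\<dots> \<le> 2 * K"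
    using add_mono[OF assms] by (simp add: mult_2)
  finally show ?thesis .
qed

text \<open>The double integral is linear, not quadratic, in the volume: for fixed \<open>z\<close> the location of \<open>y\<close> is
  integrated against \<open>g\<close> over the whole space, and only the location of \<open>z\<close> remains in the window.\<close>

lemma interaction_mean_le:
  fixes g :: "real ^ 'd \<Rightarrow> ennreal"
  assumes [measurable]: "\<Lambda> \<in> sets borel" "A \<in> sets borel" "g \<in> borel_measurable borel"
    and bound: "\<And>m. m \<in> A \<Longrightarrow> square_intensity m \<le> K"
  shows "(\<integral>\<^sup>+ \<gamma>. (\<integral>\<^sup>+ z. (\<integral>\<^sup>+ y. indicator (\<Lambda> \<times> A) z * intensity z \<gamma> *
       (indicator (\<Lambda> \<times> A) y * intensity y \<gamma> * g (fst y - fst z)) \<partial>\<nu>) \<partial>\<nu>) \<partial>\<Gamma>) \<le>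
    emeasure lborel \<Lambda> * (emeasure \<mu> A * emeasure \<mu> A * (2 * K * (\<integral>\<^sup>+ u. g u \<partial>lborel)))"
proof -
  let ?B = "\<Lambda> \<times> A"
  let ?f = "\<lambda>z y \<gamma>. indicator ?B z * intensity z \<gamma> * (indicator ?B y * intensity y \<gamma> * g (fst y - fst z))"
  let ?G = "\<integral>\<^sup>+ u. g u \<partial>lborel"
  have shift: "(\<integral>\<^sup>+ x. g (x - c) \<partial>lborel) = ?G" for c
  proof -
    have "?G = (\<integral>\<^sup>+ u. g u \<partial>distr lborel borel ((+) (- c)))" by (simp only: lborel_distr_plus)
    also have "\<dots> = (\<integral>\<^sup>+ x. g (x - c) \<partial>lborel)" by (subst nn_integral_distr) auto
    finally show ?thesis by simp
  qed
  have "(\<integral>\<^sup>+ \<gamma>. (\<integral>\<^sup>+ z. (\<integral>\<^sup>+ y. ?f z y \<gamma> \<partial>\<nu>) \<partial>\<nu>) \<partial>\<Gamma>) =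
      (\<integral>\<^sup>+ z. (\<integral>\<^sup>+ \<gamma>. (\<integral>\<^sup>+ y. ?f z y \<gamma> \<partial>\<nu>) \<partial>\<Gamma>) \<partial>\<nu>)"
    by (rule two.Fubini') measurable
  also have "\<dots> = (\<integral>\<^sup>+ z. (\<integral>\<^sup>+ y. (\<integral>\<^sup>+ \<gamma>. ?f z y \<gamma> \<partial>\<Gamma>) \<partial>\<nu>) \<partial>\<nu>)"
    by (intro nn_integral_cong two.Fubini') measurable
  also have "\<dots> \<le> (\<integral>\<^sup>+ z. (\<integral>\<^sup>+ y. indicator ?B z *
      (2 * K * (indicator (UNIV \<times> A) y * (g (fst y - fst z) * 1))) \<partial>\<nu>) \<partial>\<nu>)"
  proof (intro nn_integral_mono)
    fix z y
    let ?c = "indicator ?B z * (indicator ?B y * g (fst y - fst z))"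
    have "(\<integral>\<^sup>+ \<gamma>. ?f z y \<gamma> \<partial>\<Gamma>) = (\<integral>\<^sup>+ \<gamma>. ?c * (intensity z \<gamma> * intensity y \<gamma>) \<partial>\<Gamma>)"
      by (simp add: mult_ac)
    also have "\<dots> = ?c * (\<integral>\<^sup>+ \<gamma>. intensity z \<gamma> * intensity y \<gamma> \<partial>\<Gamma>)"
      by (rule nn_integral_cmult) measurable
    also have "\<dots> \<le> ?c * (2 * K)"
      using intensity_product_mean_le[of z K y] bound
      by (auto simp: indicator_def intro!: mult_left_mono)
    also have "\<dots> \<le> indicator ?B z * (2 * K * (indicator (UNIV \<times> A) y * (g (fst y - fst z) * 1)))"
      by (auto simp: indicator_def mult_ac)
    finally show "(\<integral>\<^sup>+ \<gamma>. ?f z y \<gamma> \<partial>\<Gamma>) \<le>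
      indicator ?B z * (2 * K * (indicator (UNIV \<times> A) y * (g (fst y - fst z) * 1)))" .
  qed
  also have "\<dots> = (\<integral>\<^sup>+ z. indicator ?B z * (2 * K * (?G * emeasure \<mu> A)) \<partial>\<nu>)"
  proof (rule nn_integral_cong)
    fix z :: "(real ^ 'd) \<times> 'm"
    have "(\<integral>\<^sup>+ y. indicator (UNIV \<times> A) y * (g (fst y - fst z) * 1) \<partial>\<nu>) = ?G * emeasure \<mu> A"
      by (subst nn_integral_window) (simp_all add: shift)
    then show "(\<integral>\<^sup>+ y. indicator ?B z *
        (2 * K * (indicator (UNIV \<times> A) y * (g (fst y - fst z) * 1))) \<partial>\<nu>) =
        indicator ?B z * (2 * K * (?G * emeasure \<mu> A))"
      by (simp add: nn_integral_cmult del: mult_1_right)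
  qed
  also have "\<dots> = emeasure lborel \<Lambda> * emeasure \<mu> A * (2 * K * (?G * emeasure \<mu> A))"
    by (simp add: nn_integral_multc marks.emeasure_pair_measure_Times)
  finally show ?thesis by (simp add: mult_ac)
qed

text \<open>Second moments of the intensity are finite mark by mark but not uniformly, so they are bounded on
  a set \<open>A\<close> of marks only. The sets where they are at most \<open>n\<close> exhaust the mark space; if all of them
  had zero mean intensity, the expected number of points in every ball would vanish, and the process
  would be empty.\<close>

lemma exists_mark_set:
  assumes finite: "\<And>m. square_intensity m < top"
    and nonempty: "\<not> (AE \<gamma> in \<Gamma>. \<gamma> = {})"
  obtains A and K :: real where "A \<in> sets borel" "0 \<le> K" "\<And>m. m \<in> A \<Longrightarrow> square_intensity m \<le> ennreal K"
    "0 < (\<integral>\<^sup>+ m. indicator A m * mean_intensity m \<partial>\<mu>)"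
    "(\<integral>\<^sup>+ m. indicator A m * mean_intensity m \<partial>\<mu>) < top"
proof -
  define A where "A n = {m. square_intensity m \<le> ennreal (real n)}" for n :: nat
  have [measurable]: "A n \<in> sets borel" for n
    unfolding A_def by measurable
  have "\<exists>n. 0 < (\<integral>\<^sup>+ m. indicator (A n) m * mean_intensity m \<partial>\<mu>)"
  proof (rule ccontr)
    assume "\<not> ?thesis"
    then have "(\<integral>\<^sup>+ m. indicator (A n) m * mean_intensity m \<partial>\<mu>) = 0" for n
      by (simp add: not_less)
    then have "AE m in \<mu>. indicator (A n) m * mean_intensity m = 0" for n
      by (subst (asm) nn_integral_0_iff_AE) auto
    then have "AE m in \<mu>. \<forall>n. indicator (A n) m * mean_intensity m = 0"
      unfolding AE_all_countable by blast
    then have "AE m in \<mu>. mean_intensity m = 0"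
    proof eventually_elim
      case (elim m)
      obtain r where "0 \<le> r" "square_intensity m = ennreal r"
        using finite[of m] by (auto elim: ennreal_cases simp: less_top)
      then obtain n where "m \<in> A n"
        using real_arch_simple[of r] by (auto simp: A_def ennreal_leI)
      then show ?case using elim[rule_format, of n] by simp
    qed
    then have no_intensity: "(\<integral>\<^sup>+ m. mean_intensity m \<partial>\<mu>) = 0"
      by (subst nn_integral_0_iff_AE) auto
    have "AE \<gamma> in \<Gamma>. point_count (ball 0 (real n) \<times> UNIV) \<gamma> = 0" for n
    proof -
      have "(\<integral>\<^sup>+ \<gamma>. point_count (ball 0 (real n) \<times> UNIV) \<gamma> \<partial>\<Gamma>) = 0"
        by (subst count_compensator_mean, measurable, subst compensator_mean) (simp_all add: no_intensity)
      then show ?thesis by (subst (asm) nn_integral_0_iff_AE) auto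
    qed
    then have "AE \<gamma> in \<Gamma>. \<forall>n. point_count (ball 0 (real n) \<times> UNIV) \<gamma> = 0"
      unfolding AE_all_countable by blast
    then have "AE \<gamma> in \<Gamma>. \<gamma> = {}"
    proof eventually_elim
      case (elim \<gamma>)
      have "z \<notin> \<gamma>" for z
      proof
        assume "z \<in> \<gamma>"
        moreover obtain n :: nat where "norm (fst z) < real n" using reals_Archimedean2 by blast
        ultimately have "z \<in> \<gamma> \<inter> ball 0 (real n) \<times> UNIV" by (auto simp: mem_Times_iff)
        then show False using elim[rule_format, of n]
          by (auto simp: point_count_def emeasure_count_space_eq_0)
      qed
      then show ?case by blast
    qed
    with nonempty show False by blast
  qed
  then obtain n where n: "0 < (\<integral>\<^sup>+ m. indicator (A n) m * mean_intensity m \<partial>\<mu>)" by blast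
  have "mean_intensity m \<le> 1 + square_intensity m" for m
  proof -
    have "a \<le> 1 + a\<^sup>2" for a :: ennreal
    proof (cases "a \<le> 1")
      case False
      then have "a * 1 \<le> a * a" by (intro mult_left_mono) auto
      then show ?thesis by (simp add: power2_eq_square add_increasing)
    qed (simp add: add_increasing2)
    then have "mean_intensity m \<le> (\<integral>\<^sup>+ \<gamma>. 1 + (intensity (0, m) \<gamma>)\<^sup>2 \<partial>\<Gamma>)"
      unfolding mean_intensity_def by (intro nn_integral_mono)
    also have "\<dots> = 1 + square_intensity m"
      unfolding square_intensity_def by (subst nn_integral_add) (auto simp: emeasure_space_1)
    finally show ?thesis .
  qed
  then have "indicator (A n) m * mean_intensity m \<le> 1 + ennreal (real n)" for m
    by (auto simp: indicator_def A_def intro: order_trans add_left_mono)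
  then have "(\<integral>\<^sup>+ m. indicator (A n) m * mean_intensity m \<partial>\<mu>) \<le> (\<integral>\<^sup>+ m. 1 + ennreal (real n) \<partial>\<mu>)"
    by (intro nn_integral_mono)
  also have "\<dots> < top"
    using marks.finite_emeasure_space by (auto simp: ennreal_mult_eq_top_iff less_top[symmetric])
  finally show ?thesis
    using n by (intro that[of "A n" "real n"]) (auto simp: A_def)
qed

end

text \<open>The function bounding the interaction is only Lebesgue measurable, but Tonelli on the product
  with the marks is applied to Borel functions. A Borel function equal to it almost everywhere is
  made a bound everywhere by the value \<open>\<infinity>\<close> on the exceptional null set. On the ball of radius
  \<open>\<delta>\<close> the value 1 suffices, because there the trivial estimate
  \<open>\<lambda>\<^sup>*(y, \<gamma>) - \<lambda>\<^sup>*(y, \<gamma> \<union> {z}) \<le> \<lambda>\<^sup>*(y, \<gamma>)\<close> is used.\<close>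

lemma interaction_majorant:
  fixes \<phi> :: "'a::euclidean_space \<Rightarrow> real"
  assumes "set_integrable lebesgue (- ball 0 \<delta>) \<phi>"
  obtains g :: "'a \<Rightarrow> ennreal" where "g \<in> borel_measurable borel" "(\<integral>\<^sup>+ u. g u \<partial>lborel) < top"
    "\<And>u. norm u \<le> \<delta> \<Longrightarrow> 1 \<le> g u" "\<And>u. norm u > \<delta> \<Longrightarrow> ennreal (\<phi> u) \<le> g u"
proof -
  define f where "f u = ennreal (indicator (- ball 0 \<delta>) u *\<^sub>R \<phi> u)" for u
  have int: "integrable lebesgue (\<lambda>u. indicator (- ball 0 \<delta>) u *\<^sub>R \<phi> u)"
    using assms by (simp add: set_integrable_def)
  have f_meas: "f \<in> borel_measurable (completion lborel)"
    unfolding f_def using borel_measurable_integrable[OF int] by measurable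
  then obtain g0 where [measurable]: "g0 \<in> borel_measurable lborel" and ae: "AE u in lborel. f u = g0 u"
    using completion_ex_borel_measurable by blast
  from AE_E[OF ae] obtain E where E: "{u. f u \<noteq> g0 u} \<subseteq> E" "emeasure lborel E = 0" "E \<in> sets lborel"
    by auto
  then have [measurable]: "E \<in> sets borel" by simp
  have [measurable]: "cball (0 :: 'a) \<delta> \<in> sets borel" by (intro borel_closed closed_cball)
  define g where "g u = indicator (cball 0 \<delta>) u + (if u \<in> E then top else g0 u)" for u
  have "(\<integral>\<^sup>+ u. g u \<partial>lborel) = emeasure lborel (cball 0 \<delta> :: 'a set) + (\<integral>\<^sup>+ u. (if u \<in> E then top else g0 u) \<partial>lborel)"
    unfolding g_def by (subst nn_integral_add) auto
  also have "(\<integral>\<^sup>+ u. (if u \<in> E then top else g0 u) \<partial>lborel) = (\<integral>\<^sup>+ u. g0 u \<partial>lborel)"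
    using AE_not_in[of E lborel] E by (intro nn_integral_cong_AE) (auto simp: null_sets_def elim!: eventually_mono)
  also have "(\<integral>\<^sup>+ u. g0 u \<partial>lborel) = (\<integral>\<^sup>+ u. f u \<partial>lebesgue)"
    using AE_completion[OF ae] by (subst nn_integral_completion[symmetric]) (auto intro!: nn_integral_cong_AE)
  also have "\<dots> < top"
  proof -
    have "(\<integral>\<^sup>+ u. f u \<partial>lebesgue) \<le> (\<integral>\<^sup>+ u. ennreal (norm (indicator (- ball 0 \<delta>) u *\<^sub>R \<phi> u)) \<partial>lebesgue)"
      unfolding f_def by (intro nn_integral_mono ennreal_leI) (simp only: real_norm_def abs_ge_self)
    also have "\<dots> < top" using int by (simp add: integrable_iff_bounded)
    finally show ?thesis .
  qed
  finally have finite_integral: "(\<integral>\<^sup>+ u. g u \<partial>lborel) < top"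
    using emeasure_bounded_finite[OF bounded_cball, of "0 :: 'a" \<delta>] by simp
  have "g \<in> borel_measurable borel"
    unfolding g_def by measurable
  moreover note finite_integral
  moreover have "1 \<le> g u" if "norm u \<le> \<delta>" for u
    using that by (simp add: g_def)
  moreover have "ennreal (\<phi> u) \<le> g u" if "norm u > \<delta>" for u
  proof -
    have "f u = g0 u" if "u \<notin> E" using E(1) that by blast
    then have "f u \<le> g u" by (cases "u \<in> E") (auto simp: g_def intro: add_increasing)
    then show ?thesis using that by (simp add: f_def)
  qed
  ultimately show ?thesis by (rule that)
qed

text \<open>The one-sided, truncated form of the hypothesis on intensity ratios: for \<open>a \<le> 0\<close> the left-hand
  side vanishes.\<close>

lemma ennreal_le_of_ratio_bound:
  fixes a b c :: real
  assumes "a \<noteq> 0 \<Longrightarrow> \<bar>1 - b / a\<bar> \<le> c"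
  shows "ennreal a \<le> ennreal b + ennreal a * ennreal c"
proof (cases "a > 0")
  case True
  then have c: "\<bar>1 - b / a\<bar> \<le> c" using assms by simp
  then have "1 - b / a \<le> c" by linarith
  then have "a \<le> b + a * c" using True by (simp add: field_simps)
  then have "ennreal a \<le> ennreal (max 0 b + a * c)" by (intro ennreal_leI) linarith
  also have "\<dots> = ennreal (max 0 b) + ennreal (a * c)"
    using True c by (intro ennreal_plus mult_nonneg_nonneg) (auto intro: order_trans[OF abs_ge_zero])
  also have "\<dots> = ennreal b + ennreal a * ennreal c"
    using True by (simp add: ennreal_mult' max_def ennreal_neg)
  finally show ?thesis .
qed (simp add: ennreal_neg)

section \<open>The variance bound\<close>

lemma nn_integral_finite_real:
  fixes f :: "'a \<Rightarrow> real"
  assumes "f \<in> borel_measurable M" "\<And>x. 0 \<le> f x" "(\<integral>\<^sup>+ x. ennreal (f x) \<partial>M) < top"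
  shows "integrable M f" "(\<integral>\<^sup>+ x. ennreal (f x) \<partial>M) = ennreal (\<integral>x. f x \<partial>M)"
proof -
  show "integrable M f" using assms by (intro integrableI_nonneg) auto
  then show "(\<integral>\<^sup>+ x. ennreal (f x) \<partial>M) = ennreal (\<integral>x. f x \<partial>M)"
    using assms by (intro nn_integral_eq_integral) auto
qed

text \<open>A quantitative Cauchy-Schwarz inequality for \<open>N\<close> against \<open>S - T\<close>. The two mean equalities and
  \<open>cross\<close> say that their covariance is \<open>m\<close>; \<open>square\<close> and \<open>compensated\<close> say that
  \<open>E (S - T)\<^sup>2 \<le> m + r\<close>. Taking the mean of \<open>(N - E N - t (S - T))\<^sup>2 \<ge> 0\<close> gives the bound. The moment
  hypotheses are equations in \<open>[0, \<infinity>]\<close>; if the variance is finite, so are all the moments in them.\<close>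

lemma variance_lower_bound:
  fixes N S T :: "'a \<Rightarrow> real" and m r t :: real
  assumes "prob_space M"
    and [measurable]: "N \<in> borel_measurable M" "S \<in> borel_measurable M" "T \<in> borel_measurable M"
    and nonneg: "\<And>x. 0 \<le> S x" "\<And>x. 0 \<le> T x" "0 \<le> m" "0 \<le> r"
    and SN: "\<And>x. x \<in> space M \<Longrightarrow> S x \<le> N x" and N0: "\<And>x. 0 \<le> N x"
    and S: "(\<integral>\<^sup>+ x. ennreal (S x) \<partial>M) = ennreal m"
    and T: "(\<integral>\<^sup>+ x. ennreal (T x) \<partial>M) = ennreal m"
    and cross: "(\<integral>\<^sup>+ x. ennreal (S x * N x) \<partial>M) = (\<integral>\<^sup>+ x. ennreal (T x * N x) \<partial>M) + ennreal m"
    and square: "(\<integral>\<^sup>+ x. ennreal (S x * S x) \<partial>M) = (\<integral>\<^sup>+ x. ennreal (T x * S x) \<partial>M) + ennreal m"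
    and compensated: "(\<integral>\<^sup>+ x. ennreal (T x * T x) \<partial>M) \<le> (\<integral>\<^sup>+ x. ennreal (T x * S x) \<partial>M) + ennreal r"
  shows "ennreal (2 * t * m - t\<^sup>2 * (m + r)) \<le> ext_variance M N"
proof (cases "ext_variance M N < top")
  case True
  interpret prob_space M by fact
  define c where "c = integral\<^sup>L M N"
  have V: "integrable M (\<lambda>x. (N x - c)\<^sup>2)"
      "ext_variance M N = ennreal (\<integral>x. (N x - c)\<^sup>2 \<partial>M)"
    using True nn_integral_finite_real[of "\<lambda>x. (N x - c)\<^sup>2" M]
    by (simp_all add: ext_variance_def c_def)
  have NN: "integrable M (\<lambda>x. N x * N x)"
  proof (rule Bochner_Integration.integrable_bound)
    show "integrable M (\<lambda>x. 2 * (N x - c)\<^sup>2 + 2 * c\<^sup>2)" using V(1) by simp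
    have "a * a \<le> 2 * (a - c)\<^sup>2 + 2 * c\<^sup>2" for a :: real
      using zero_le_power2[of "a - 2 * c"] by (simp add: power2_eq_square algebra_simps)
    then show "AE x in M. norm (N x * N x) \<le> norm (2 * (N x - c)\<^sup>2 + 2 * c\<^sup>2)"
      by simp
  qed measurable
  \<comment> \<open>Finiteness spreads from the square of \<open>N\<close> to all products, by \<open>S \<le> N\<close> and the moment hypotheses.\<close>
  have iSN: "integrable M (\<lambda>x. S x * N x)" and iSS: "integrable M (\<lambda>x. S x * S x)"
    by (rule Bochner_Integration.integrable_bound[OF NN];
        use nonneg(1) N0 SN in \<open>auto intro!: AE_I2 mult_mono simp: abs_mult\<close>)+
  have fSN: "(\<integral>\<^sup>+ x. ennreal (S x * N x) \<partial>M) < top" and fSS: "(\<integral>\<^sup>+ x. ennreal (S x * S x) \<partial>M) < top"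
    using iSN iSS nonneg(1) N0 by (simp_all add: nn_integral_eq_integral)
  have fTN: "(\<integral>\<^sup>+ x. ennreal (T x * N x) \<partial>M) < top" using fSN cross by simp
  have fTS: "(\<integral>\<^sup>+ x. ennreal (T x * S x) \<partial>M) < top" using fSS square by simp
  have fTT: "(\<integral>\<^sup>+ x. ennreal (T x * T x) \<partial>M) < top"
    using fTS by (intro le_less_trans[OF compensated]) simp
  note i = iSN iSS
    nn_integral_finite_real(1)[OF _ _ fTN] nn_integral_finite_real(1)[OF _ _ fTS]
    nn_integral_finite_real(1)[OF _ _ fTT]
  have iS: "integrable M S" "integral\<^sup>L M S = m" and iT: "integrable M T" "integral\<^sup>L M T = m"
    using nn_integral_finite_real[of S M] nn_integral_finite_real[of T M] S T nonneg
    by (simp_all add: ennreal_inj)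
  have [simp]: "integrable M (\<lambda>x. S x * N x)" "integrable M (\<lambda>x. S x * S x)"
    "integrable M (\<lambda>x. T x * N x)" "integrable M (\<lambda>x. T x * S x)" "integrable M (\<lambda>x. T x * T x)"
    "integrable M S" "integrable M T"
    using i iS iT nonneg N0 by simp_all
  have pos: "0 \<le> (\<integral>x. T x * N x \<partial>M)" "0 \<le> (\<integral>x. T x * S x \<partial>M)" "0 \<le> (\<integral>x. S x * N x \<partial>M)"
    "0 \<le> (\<integral>x. S x * S x \<partial>M)"
    using nonneg N0 by (auto intro!: integral_nonneg_AE)
  have cross': "(\<integral>x. S x * N x \<partial>M) = (\<integral>x. T x * N x \<partial>M) + m"
    using cross pos nonneg N0
    by (simp add: nn_integral_eq_integral ennreal_plus[symmetric] del: ennreal_plus)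
  have square': "(\<integral>x. S x * S x \<partial>M) = (\<integral>x. T x * S x \<partial>M) + m"
    using square pos nonneg N0
    by (simp add: nn_integral_eq_integral ennreal_plus[symmetric] del: ennreal_plus)
  have compensated': "(\<integral>x. T x * T x \<partial>M) \<le> (\<integral>x. T x * S x \<partial>M) + r"
    using compensated pos nonneg N0
    by (simp add: nn_integral_eq_integral ennreal_plus[symmetric] del: ennreal_plus)
  \<comment> \<open>This is \<open>2 t (N - c) (S - T) - t\<^sup>2 (S - T)\<^sup>2\<close> with the products expanded.\<close>
  let ?q = "\<lambda>x. 2 * t * (S x * N x - T x * N x - c * S x + c * T x) -
      t\<^sup>2 * (S x * S x - 2 * (T x * S x) + T x * T x)"
  have "2 * t * m - t\<^sup>2 * (m + r) \<le> (\<integral>x. ?q x \<partial>M)"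
  proof -
    have "(\<integral>x. ?q x \<partial>M) = 2 * t * m - t\<^sup>2 * (m - (\<integral>x. T x * S x \<partial>M) + (\<integral>x. T x * T x \<partial>M))"
      using iS iT cross' square' by simp
    also have "\<dots> \<ge> 2 * t * m - t\<^sup>2 * (m + r)"
      using compensated' by (intro diff_mono order_refl mult_left_mono) auto
    finally show ?thesis .
  qed
  also have "\<dots> \<le> (\<integral>x. (N x - c)\<^sup>2 \<partial>M)"
  proof (rule integral_mono)
    fix x
    show "?q x \<le> (N x - c)\<^sup>2"
      using zero_le_power2[of "N x - c - t * (S x - T x)"]
      by (simp add: power2_eq_square algebra_simps)
  qed (use V in simp_all)
  finally show ?thesis unfolding V(2) by (rule ennreal_leI)
qed (simp add: not_less top.extremum_unique)

context stationary_gibbs_process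
begin

lemma num_points_eq_count:
  assumes "\<gamma> \<in> configs" "bounded \<Lambda>"
  shows "ennreal (num_points \<Lambda> \<gamma>) = point_count (\<Lambda> \<times> UNIV) \<gamma>"
  using finite_window[OF assms order_refl]
  by (simp add: num_points_def point_count_def emeasure_count_space ennreal_of_nat_eq_real_of_nat)

text \<open>The mean \<open>m\<close> of the compensator and the bound \<open>r\<close> on its interaction term are both proportional to
  the volume \<open>v\<close>, hence so is the resulting lower bound for the variance. All points with location in
  \<open>\<Lambda>\<close> are counted by \<open>N\<close>, but only those with marks in \<open>A\<close> are compensated.\<close>

lemma variance_ge:
  fixes g :: "real ^ 'd \<Rightarrow> ennreal" and \<rho> K G \<alpha> v t :: real
  assumes [measurable]: "\<Lambda> \<in> sets borel" "A \<in> sets borel" "g \<in> borel_measurable borel"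
    and bounded: "bounded \<Lambda>" and volume: "emeasure lborel \<Lambda> = ennreal v" "0 \<le> v"
    and marks_A: "emeasure \<mu> A = ennreal \<alpha>" "0 \<le> \<alpha>"
    and \<rho>: "(\<integral>\<^sup>+ m. indicator A m * mean_intensity m \<partial>\<mu>) = ennreal \<rho>" "0 \<le> \<rho>"
    and G: "(\<integral>\<^sup>+ u. g u \<partial>lborel) = ennreal G" "0 \<le> G"
    and K: "\<And>m. m \<in> A \<Longrightarrow> square_intensity m \<le> ennreal K" "0 \<le> K"
    and interaction: "\<And>z y \<gamma>. \<gamma> \<in> configs \<Longrightarrow>
      intensity y \<gamma> \<le> intensity y (insert z \<gamma>) + intensity y \<gamma> * g (fst y - fst z)"
  shows "ennreal (v * (2 * t * \<rho> - t\<^sup>2 * (\<rho> + \<alpha>\<^sup>2 * (2 * K * G)))) \<le> ext_variance \<Gamma> (num_points \<Lambda>)"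
proof -
  let ?B = "\<Lambda> \<times> A" and ?W = "\<Lambda> \<times> (UNIV :: 'm set)"
  define N :: "((real ^ 'd) \<times> 'm) set \<Rightarrow> real" where "N = num_points \<Lambda>"
  define S where "S \<gamma> = enn2real (point_count ?B \<gamma>)" for \<gamma>
  define T where "T \<gamma> = enn2real (compensator ?B \<gamma>)" for \<gamma>
  define m where "m = v * \<rho>"
  define r where "r = v * (\<alpha>\<^sup>2 * (2 * K * G))"
  have N_eq: "ennreal (N \<gamma>) = point_count ?W \<gamma>" if "\<gamma> \<in> configs" for \<gamma>
    unfolding N_def by (rule num_points_eq_count[OF that bounded])
  have S_eq: "ennreal (S \<gamma>) = point_count ?B \<gamma>" if "\<gamma> \<in> configs" for \<gamma>
    using finite_window[OF that bounded, of ?B] by (auto simp: S_def point_count_def emeasure_count_space ennreal_of_nat_eq_real_of_nat)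
  have mean_T: "(\<integral>\<^sup>+ \<gamma>. compensator ?B \<gamma> \<partial>\<Gamma>) = ennreal m"
    using volume \<rho> by (simp add: compensator_mean m_def ennreal_mult)
  have T_eq: "AE \<gamma> in \<Gamma>. ennreal (T \<gamma>) = compensator ?B \<gamma>"
  proof -
    have "AE \<gamma> in \<Gamma>. compensator ?B \<gamma> \<noteq> \<infinity>"
      by (rule nn_integral_PInf_AE) (simp_all add: mean_T)
    then show ?thesis by eventually_elim (simp add: T_def less_top)
  qed
  have AE_eqs: "AE \<gamma> in \<Gamma>. ennreal (N \<gamma>) = point_count ?W \<gamma> \<and> ennreal (S \<gamma>) = point_count ?B \<gamma> \<and>
      ennreal (T \<gamma>) = compensator ?B \<gamma>"
    using T_eq AE_space by eventually_elim (simp add: space_process N_eq S_eq)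
  have nonneg: "0 \<le> N \<gamma>" "0 \<le> S \<gamma>" "0 \<le> T \<gamma>" for \<gamma>
    by (simp_all add: N_def num_points_def S_def T_def)
  have meas: "N \<in> borel_measurable \<Gamma>" "S \<in> borel_measurable \<Gamma>" "T \<in> borel_measurable \<Gamma>"
  proof -
    have "(\<lambda>\<gamma>. enn2real (point_count ?W \<gamma>)) \<in> borel_measurable \<Gamma>" by measurable
    then show "N \<in> borel_measurable \<Gamma>"
      by (rule measurable_cong[THEN iffD1, rotated])
        (simp add: N_eq[symmetric] space_process nonneg)
    show "S \<in> borel_measurable \<Gamma>" "T \<in> borel_measurable \<Gamma>"
      unfolding S_def[abs_def] T_def[abs_def] by measurable
  qed
  have "ennreal (2 * t * m - t\<^sup>2 * (m + r)) \<le> ext_variance \<Gamma> N"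
  proof (rule variance_lower_bound[OF prob_space_axioms meas nonneg(2,3)])
    show "0 \<le> m" "0 \<le> r"
      using volume marks_A \<rho> G K by (simp_all add: m_def r_def)
    show "0 \<le> N \<gamma>" for \<gamma> by (rule nonneg)
    show "S \<gamma> \<le> N \<gamma>" if "\<gamma> \<in> space \<Gamma>" for \<gamma>
    proof -
      have "ennreal (S \<gamma>) \<le> ennreal (N \<gamma>)"
        using that unfolding space_process
        by (simp only: N_eq S_eq point_count_def) (auto intro!: emeasure_mono)
      then show ?thesis by (simp add: nonneg)
    qed
    show "(\<integral>\<^sup>+ \<gamma>. ennreal (T \<gamma>) \<partial>\<Gamma>) = ennreal m"
      unfolding mean_T[symmetric] using T_eq by (rule nn_integral_cong_AE)
    show "(\<integral>\<^sup>+ \<gamma>. ennreal (S \<gamma>) \<partial>\<Gamma>) = ennreal m"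
      unfolding mean_T[symmetric]
      by (subst count_compensator_mean[symmetric], measurable)
        (auto intro!: nn_integral_cong simp: space_process S_eq)
    have prods: "(\<integral>\<^sup>+ \<gamma>. ennreal (S \<gamma> * N \<gamma>) \<partial>\<Gamma>) = (\<integral>\<^sup>+ \<gamma>. point_count ?B \<gamma> * point_count ?W \<gamma> \<partial>\<Gamma>)"
      "(\<integral>\<^sup>+ \<gamma>. ennreal (T \<gamma> * N \<gamma>) \<partial>\<Gamma>) = (\<integral>\<^sup>+ \<gamma>. compensator ?B \<gamma> * point_count ?W \<gamma> \<partial>\<Gamma>)"
      "(\<integral>\<^sup>+ \<gamma>. ennreal (S \<gamma> * S \<gamma>) \<partial>\<Gamma>) = (\<integral>\<^sup>+ \<gamma>. point_count ?B \<gamma> * point_count ?B \<gamma> \<partial>\<Gamma>)"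
      "(\<integral>\<^sup>+ \<gamma>. ennreal (T \<gamma> * S \<gamma>) \<partial>\<Gamma>) = (\<integral>\<^sup>+ \<gamma>. compensator ?B \<gamma> * point_count ?B \<gamma> \<partial>\<Gamma>)"
      "(\<integral>\<^sup>+ \<gamma>. ennreal (T \<gamma> * T \<gamma>) \<partial>\<Gamma>) = (\<integral>\<^sup>+ \<gamma>. compensator ?B \<gamma> * compensator ?B \<gamma> \<partial>\<Gamma>)"
      by (rule nn_integral_cong_AE, rule eventually_mono[OF AE_eqs], simp add: ennreal_mult nonneg)+
    show "(\<integral>\<^sup>+ \<gamma>. ennreal (S \<gamma> * N \<gamma>) \<partial>\<Gamma>) = (\<integral>\<^sup>+ \<gamma>. ennreal (T \<gamma> * N \<gamma>) \<partial>\<Gamma>) + ennreal m"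
      unfolding prods mean_T[symmetric] by (rule count_product_mean) auto
    show "(\<integral>\<^sup>+ \<gamma>. ennreal (S \<gamma> * S \<gamma>) \<partial>\<Gamma>) = (\<integral>\<^sup>+ \<gamma>. ennreal (T \<gamma> * S \<gamma>) \<partial>\<Gamma>) + ennreal m"
      unfolding prods mean_T[symmetric] by (rule count_product_mean) auto
    have "(\<integral>\<^sup>+ \<gamma>. compensator ?B \<gamma> * compensator ?B \<gamma> \<partial>\<Gamma>) \<le>
        (\<integral>\<^sup>+ \<gamma>. point_count ?B \<gamma> * compensator ?B \<gamma> \<partial>\<Gamma>) +
        emeasure lborel \<Lambda> * (emeasure \<mu> A * emeasure \<mu> A * (2 * ennreal K * (\<integral>\<^sup>+ u. g u \<partial>lborel)))"
      by (rule order_trans[OF compensator_square_mean_le add_left_mono[OF interaction_mean_le]])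
        (use interaction K in auto)
    also have "emeasure lborel \<Lambda> * (emeasure \<mu> A * emeasure \<mu> A * (2 * ennreal K * (\<integral>\<^sup>+ u. g u \<partial>lborel))) =
        ennreal r"
      using volume marks_A G K by (simp add: r_def ennreal_mult power2_eq_square)
    finally show "(\<integral>\<^sup>+ \<gamma>. ennreal (T \<gamma> * T \<gamma>) \<partial>\<Gamma>) \<le> (\<integral>\<^sup>+ \<gamma>. ennreal (T \<gamma> * S \<gamma>) \<partial>\<Gamma>) + ennreal r"
      unfolding prods by (simp add: mult.commute)
  qed
  also have "2 * t * m - t\<^sup>2 * (m + r) = v * (2 * t * \<rho> - t\<^sup>2 * (\<rho> + \<alpha>\<^sup>2 * (2 * K * G)))"
    by (simp add: m_def r_def algebra_simps)
  finally show ?thesis by (simp add: N_def)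
qed

end

lemma not_hyperuniform_if_variance_ge:
  fixes \<Gamma> :: "((real ^ 'd) \<times> 'm::polish_space) set measure" and C :: real
  assumes "C > 0"
    and bound: "\<And>\<Lambda>. \<Lambda> \<in> sets borel \<Longrightarrow> bounded \<Lambda> \<Longrightarrow> emeasure lborel \<Lambda> > 0 \<Longrightarrow>
      ennreal C \<le> ext_variance \<Gamma> (num_points \<Lambda>) / emeasure lborel \<Lambda>"
  shows "\<not> hyperuniform \<Gamma>"
proof
  let ?\<Lambda> = "\<lambda>n::nat. ball (0 :: real ^ 'd) (real n + 1)"
  let ?q = "\<lambda>n. ext_variance \<Gamma> (num_points (?\<Lambda> n)) / emeasure lborel (?\<Lambda> n)"
  assume "hyperuniform \<Gamma>"
  moreover have "incseq ?\<Lambda>" by (auto simp: incseq_def)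
  moreover have "(\<Union>n. ?\<Lambda> n) = UNIV"
  proof -
    have "\<exists>n::nat. norm x < real n + 1" for x :: "real ^ 'd"
      using reals_Archimedean2[of "norm x - 1"] by (simp add: algebra_simps)
    then show ?thesis by auto
  qed
  ultimately have "?q \<longlonglongrightarrow> 0" unfolding hyperuniform_def by auto
  moreover have "ennreal C \<le> ?q n" for n
  proof (rule bound)
    show "emeasure lborel (?\<Lambda> n) > 0"
      by (simp add: emeasure_ball)
  qed auto
  ultimately have "ennreal C \<le> 0" by (intro LIMSEQ_le_const) auto
  then show False using \<open>C > 0\<close> by simp
qed

theorem theorem1:
  fixes \<mu> :: "'m::polish_space measure"
    and \<Gamma> :: "((real ^ 'd) \<times> 'm) set measure"
    and \<kappa> :: "(real ^ 'd) \<times> 'm \<Rightarrow> ((real ^ 'd) \<times> 'm) set \<Rightarrow> real"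
    and \<phi> :: "real ^ 'd \<Rightarrow> real"
    and \<delta> :: real
  assumes mark_measure: "finite_measure \<mu>" "sets \<mu> = sets borel"
    and process: "point_process \<Gamma>" "stationary \<Gamma>"
    and nonempty: "\<not> (AE \<gamma> in \<Gamma>. \<gamma> = {})"
    and gibbs: "papangelou_intensity \<mu> \<Gamma> \<kappa>"
    and invariant: "\<And>u z \<gamma>. \<gamma> \<in> configs \<Longrightarrow> \<kappa> z \<gamma> = \<kappa> (translate u z) (translate u ` \<gamma>)"
    and a1: "\<And>m. integrable \<Gamma> (\<lambda>\<gamma>. (\<kappa> (0, m) \<gamma>)\<^sup>2)"
    and a2: "\<delta> \<ge> 0"
      "set_integrable lebesgue (- ball 0 \<delta>) \<phi>"
      "\<And>x m\<^sub>x y m\<^sub>y \<gamma>. norm (x - y) > \<delta> \<Longrightarrow> \<gamma> \<in> configs \<Longrightarrow> \<kappa> (x, m\<^sub>x) \<gamma> \<noteq> 0 \<Longrightarrow>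
         \<bar>1 - \<kappa> (x, m\<^sub>x) (\<gamma> \<union> {(y, m\<^sub>y)}) / \<kappa> (x, m\<^sub>x) \<gamma>\<bar> \<le> \<phi> (x - y)"
  shows "(\<exists>C::real. C > 0 \<and>
            (\<forall>\<Lambda> \<in> sets borel. bounded \<Lambda> \<longrightarrow> emeasure lborel \<Lambda> > 0 \<longrightarrow>
               ext_variance \<Gamma> (num_points \<Lambda>) / emeasure lborel \<Lambda> \<ge> ennreal C)) \<and>
         \<not> hyperuniform \<Gamma>"
proof -
  interpret stationary_gibbs_process \<mu> \<Gamma> \<kappa>
    using mark_measure process gibbs invariant
    by (simp add: stationary_gibbs_process_def gibbs_process_def stationary_gibbs_process_axioms_def)
  have "square_intensity m < top" for m
  proof -
    have "square_intensity m \<le> (\<integral>\<^sup>+ \<gamma>. ennreal ((\<kappa> (0, m) \<gamma>)\<^sup>2) \<partial>\<Gamma>)"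
      unfolding square_intensity_def intensity_def
    proof (rule nn_integral_mono)
      fix \<gamma>
      show "(ennreal (\<kappa> (0, m) \<gamma>))\<^sup>2 \<le> ennreal ((\<kappa> (0, m) \<gamma>)\<^sup>2)"
        by (cases "0 \<le> \<kappa> (0, m) \<gamma>") (simp_all add: ennreal_power ennreal_neg)
    qed
    also have "\<dots> < top"
      using a1[of m] by (simp add: nn_integral_eq_integral)
    finally show ?thesis .
  qed
  then obtain A and K :: real where A [measurable]: "A \<in> sets borel" and "0 \<le> K"
      and K: "\<And>m. m \<in> A \<Longrightarrow> square_intensity m \<le> ennreal K"
      and pos: "0 < (\<integral>\<^sup>+ m. indicator A m * mean_intensity m \<partial>\<mu>)"
      and fin: "(\<integral>\<^sup>+ m. indicator A m * mean_intensity m \<partial>\<mu>) < top"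
    by (rule exists_mark_set[OF _ nonempty]) blast
  obtain g where g [measurable]: "g \<in> borel_measurable borel" and g_fin: "(\<integral>\<^sup>+ u. g u \<partial>lborel) < top"
      and g1: "\<And>u. norm u \<le> \<delta> \<Longrightarrow> 1 \<le> g u" and g2: "\<And>u. norm u > \<delta> \<Longrightarrow> ennreal (\<phi> u) \<le> g u"
    using interaction_majorant[OF a2(2)] by metis
  have interaction: "intensity y \<gamma> \<le> intensity y (insert z \<gamma>) + intensity y \<gamma> * g (fst y - fst z)"
    if "\<gamma> \<in> configs" for z y \<gamma>
  proof (cases "norm (fst y - fst z) \<le> \<delta>")
    case True
    then have "intensity y \<gamma> * 1 \<le> intensity y \<gamma> * g (fst y - fst z)"
      by (intro mult_left_mono g1) auto
    then show ?thesis by (simp add: add_increasing)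
  next
    case False
    have "intensity y \<gamma> \<le> intensity y (insert z \<gamma>) + intensity y \<gamma> * ennreal (\<phi> (fst y - fst z))"
      unfolding intensity_def
      using False a2(3)[of "fst y" "fst z" \<gamma> "snd y" "snd z"] that
      by (intro ennreal_le_of_ratio_bound) simp
    also have "\<dots> \<le> intensity y (insert z \<gamma>) + intensity y \<gamma> * g (fst y - fst z)"
      using False by (intro add_left_mono mult_left_mono g2) auto
    finally show ?thesis .
  qed
  obtain \<rho> where \<rho>: "(\<integral>\<^sup>+ m. indicator A m * mean_intensity m \<partial>\<mu>) = ennreal \<rho>" "0 \<le> \<rho>"
    using fin by (cases rule: ennreal_cases) auto
  with pos have "0 < \<rho>" by simp
  obtain G where G: "(\<integral>\<^sup>+ u. g u \<partial>lborel) = ennreal G" "0 \<le> G"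
    using g_fin by (cases rule: ennreal_cases) auto
  define c where "c = (measure \<mu> A)\<^sup>2 * (2 * K * G)"
  have "0 \<le> c" using \<open>0 \<le> K\<close> G by (simp add: c_def)
  \<comment> \<open>The maximum over \<open>t\<close> of \<open>2 t \<rho> - t\<^sup>2 (\<rho> + c)\<close>, attained at \<open>t = \<rho> / (\<rho> + c)\<close>.\<close>
  define C where "C = \<rho>\<^sup>2 / (\<rho> + c)"
  have "C > 0" using \<open>0 < \<rho>\<close> \<open>0 \<le> c\<close> by (simp add: C_def add_pos_nonneg)
  have bound: "ennreal C \<le> ext_variance \<Gamma> (num_points \<Lambda>) / emeasure lborel \<Lambda>"
    if [measurable]: "\<Lambda> \<in> sets borel" and "bounded \<Lambda>" "emeasure lborel \<Lambda> > 0" for \<Lambda>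
  proof -
    obtain v where v: "emeasure lborel \<Lambda> = ennreal v" "0 \<le> v"
      using emeasure_bounded_finite[OF \<open>bounded \<Lambda>\<close>] by (cases rule: ennreal_cases) auto
    with that have "0 < v" by simp
    let ?t = "\<rho> / (\<rho> + c)"
    have "?t\<^sup>2 * (\<rho> + c) = C"
      using \<open>0 < \<rho>\<close> \<open>0 \<le> c\<close> by (simp add: C_def power2_eq_square)
    then have "2 * ?t * \<rho> - ?t\<^sup>2 * (\<rho> + c) = C"
      by (simp add: C_def power2_eq_square)
    then have "ennreal (v * C) \<le> ext_variance \<Gamma> (num_points \<Lambda>)"
      using variance_ge[OF that(1) A g \<open>bounded \<Lambda>\<close> v marks.emeasure_eq_measure measure_nonneg \<rho> G K
          \<open>0 \<le> K\<close> interaction, of ?t]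
      by (simp add: c_def)
    then have "ennreal (v * C) / ennreal v \<le> ext_variance \<Gamma> (num_points \<Lambda>) / emeasure lborel \<Lambda>"
      unfolding v(1) by (rule divide_right_mono_ennreal)
    then show ?thesis using \<open>0 < v\<close> \<open>C > 0\<close> by (simp add: divide_ennreal)
  qed
  then show ?thesis
    using \<open>C > 0\<close> not_hyperuniform_if_variance_ge[of C \<Gamma>] by blast
qed

end
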